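(* Let $G$ be a simple graph with chromatic number $\chi(G)$ and complement $\overline{G}$. Then $$\lceil \vartheta(\overline{G})\rceil \leq h(G)\leq \chi(G).$$
   Context: Graphs $G=(V,E)$ are finite and simple with $n=|V|\ge 1$ vertices. $\mathbb{S}^V$ is the set of real symmetric matrices with rows and columns indexed by $V$, and $\lambda_1(M)\ge\dots\ge\lambda_n(M)$ are the eigenvalues of $M\in\mathbb{S}^V$ with multiplicity. The condition "$Z_{ij}=0$ for all $ij\notin E$" includes the diagonal positions, so $Z$ has zero diagonal. $h(G)$ is the smallest integer $m\ge1$ such that for all $Z\in\mathbb{S}^V$ with $Z_{ij}=0$ for all $ij\notin E$, $$\lambda_1(Z)+\lambda_n(Z)+\lambda_{n-1}(Z)+\dots+\lambda_{n-m+2}(Z)\le 0,$$ i.e. $\lambda_1(Z)+\sum_{i=1}^{m-1}\lambda_{n+1-i}(Z)\le0$ (for $m=1$ the condition is $\lambda_1(Z)\le0$). The Lovász theta number of a graph $H$ is $$\vartheta(H)=\max\{\langle J,X\rangle : X \text{ real symmetric indexed by } V(H),\ \operatorname{tr}X=1,\ X_{ij}=0\ \forall ij\in E(H),\ X\succcurlyeq0\},$$ where $J$ is the all-ones matrix, $\langle A,B\rangle=\operatorname{tr}(AB)$, and $X\succcurlyeq 0$ means positive semidefinite. *)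

theory Defs
  imports
    "HOL-Analysis.Analysis"
    "HOL-Computational_Algebra.Polynomial"
begin

(* A finite simple graph is given by its adjacency relation; the vertex set is the universe of
   the vertex type, which is finite (class finite) and nonempty, and matrices indexed by the
   vertices have type real^'v^'v. *)

definition simple_graph :: "('v::finite \<Rightarrow> 'v \<Rightarrow> bool) \<Rightarrow> bool" where
  "simple_graph E \<longleftrightarrow> (\<forall>u v. E u v \<longrightarrow> E v u) \<and> (\<forall>v. \<not> E v v)"

definition complement_graph :: "('v \<Rightarrow> 'v \<Rightarrow> bool) \<Rightarrow> 'v \<Rightarrow> 'v \<Rightarrow> bool" where
  "complement_graph E u v \<longleftrightarrow> u \<noteq> v \<and> \<not> E u v"

definition colorable :: "('v \<Rightarrow> 'v \<Rightarrow> bool) \<Rightarrow> nat \<Rightarrow> bool" where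
  "colorable E k \<longleftrightarrow> (\<exists>c :: 'v \<Rightarrow> nat. (\<forall>v. c v < k) \<and> (\<forall>u v. E u v \<longrightarrow> c u \<noteq> c v))"

definition chromatic_number :: "('v \<Rightarrow> 'v \<Rightarrow> bool) \<Rightarrow> nat" where
  "chromatic_number E = (LEAST k. colorable E k)"

definition sym_matrix :: "real^'v^'v \<Rightarrow> bool" where
  "sym_matrix M \<longleftrightarrow> transpose M = M"

definition pos_semidef :: "real^'v^'v \<Rightarrow> bool" where
  "pos_semidef M \<longleftrightarrow> sym_matrix M \<and> (\<forall>x. 0 \<le> x \<bullet> (M *v x))"

definition characteristic_poly :: "real^'v^'v \<Rightarrow> real poly" where
  "characteristic_poly M = det (mat [:0, 1:] - map_matrix (\<lambda>a. [:a:]) M)"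

(* The k-th largest eigenvalue, k = 1, ..., n, counted with multiplicity. Only meant for symmetric
   matrices: all roots of their characteristic polynomial are real, so that the list has exactly
   n = CARD('v) entries. *)
definition eigval :: "nat \<Rightarrow> real^'v^'v \<Rightarrow> real" where
  "eigval k M = rev (sorted_list_of_multiset (proots (characteristic_poly M))) ! (k - 1)"

(* "\<not> E i j" includes i = j, so Z has zero diagonal. *)
definition supported_on :: "('v \<Rightarrow> 'v \<Rightarrow> bool) \<Rightarrow> real^'v^'v \<Rightarrow> bool" where
  "supported_on E Z \<longleftrightarrow> sym_matrix Z \<and> (\<forall>i j. \<not> E i j \<longrightarrow> Z $ i $ j = 0)"

(* For m = n the sum of eigenvalues is the trace of Z, which is zero, so the minimum is at most n;
   values m > n + 1, where the index CARD('v) + 1 - i would drop below 1, play no role. *)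
definition h_number :: "('v::finite \<Rightarrow> 'v \<Rightarrow> bool) \<Rightarrow> nat" where
  "h_number E = (LEAST m. 1 \<le> m \<and>
     (\<forall>Z. supported_on E Z \<longrightarrow>
        eigval 1 Z + (\<Sum>i = 1..m - 1. eigval (CARD('v) + 1 - i) Z) \<le> 0))"

definition theta_feasible :: "('v::finite \<Rightarrow> 'v \<Rightarrow> bool) \<Rightarrow> (real^'v^'v) set" where
  "theta_feasible E =
     {X. sym_matrix X \<and> trace X = 1 \<and> (\<forall>i j. E i j \<longrightarrow> X $ i $ j = 0) \<and> pos_semidef X}"

definition all_ones :: "real^'v^'v" where
  "all_ones = (\<chi> i j. 1)"

(* The supremum is a maximum for every simple graph: see lovasz_theta_attained. *)
definition lovasz_theta :: "('v::finite \<Rightarrow> 'v \<Rightarrow> bool) \<Rightarrow> real" where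
  "lovasz_theta E = (SUP X\<in>theta_feasible E. trace (all_ones ** X))"

lemma quad_form: "x \<bullet> (X *v x) = (\<Sum>i\<in>UNIV. \<Sum>j\<in>UNIV. x $ i * (X $ i $ j * x $ j))"
  for X :: "real^'v::finite^'v"
  by (simp add: inner_vec_def matrix_vector_mult_def sum_distrib_left)

lemma theta_feasible_entry_bound:
  fixes X :: "real^'v::finite^'v"
  assumes "X \<in> theta_feasible E"
  shows "\<bar>X $ i $ j\<bar> \<le> 1"
proof -
  have sym: "X $ a $ b = X $ b $ a" for a b
  proof -
    have "transpose X = X" using assms by (simp add: theta_feasible_def sym_matrix_def)
    then have "transpose X $ b $ a = X $ b $ a" by simp
    then show ?thesis by (simp add: transpose_def)
  qed
  have psd: "0 \<le> x \<bullet> (X *v x)" for x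
    using assms by (simp add: theta_feasible_def pos_semidef_def)
  have tr: "(\<Sum>a\<in>UNIV. X $ a $ a) = 1"
    using assms by (simp add: theta_feasible_def trace_def)
  have ent: "axis a 1 \<bullet> (X *v axis b 1) = X $ a $ b" for a b
    by (simp add: inner_axis' matrix_vector_mul_component inner_axis)
  have diag0: "0 \<le> X $ a $ a" for a
    using psd[of "axis a 1"] ent[of a a] by simp
  have diag1: "X $ a $ a \<le> 1" for a
    using member_le_sum[of a UNIV "\<lambda>a. X $ a $ a"] diag0 tr by simp
  have "0 \<le> X $ i $ i + X $ j $ j + 2 * X $ i $ j"
    using psd[of "axis i 1 + axis j 1"] sym[of i j]
    by (simp add: matrix_vector_right_distrib inner_add_left inner_add_right ent)
  moreover have "0 \<le> X $ i $ i + X $ j $ j - 2 * X $ i $ j"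
    using psd[of "axis i 1 - axis j 1"] sym[of i j]
    by (simp add: matrix_vector_mult_diff_distrib inner_diff_left inner_diff_right ent)
  ultimately show ?thesis using diag1[of i] diag1[of j] by linarith
qed

lemma compact_theta_feasible: "compact (theta_feasible E)"
proof -
  have "closed (theta_feasible E)"
    unfolding theta_feasible_def pos_semidef_def sym_matrix_def quad_form trace_def vec_eq_iff
      transpose_def
    by (intro closed_Collect_conj closed_Collect_all closed_Collect_imp closed_Collect_eq
        closed_Collect_le open_Collect_const) (auto intro!: continuous_intros)
  moreover have "bounded (theta_feasible E)"
  proof (rule boundedI)
    fix X assume X: "X \<in> theta_feasible E"
    have "norm X \<le> (\<Sum>i\<in>UNIV. norm (X $ i))" by (simp add: norm_vec_def L2_set_le_sum)
    also have "\<dots> \<le> (\<Sum>i\<in>(UNIV :: 'a set). \<Sum>j\<in>(UNIV :: 'a set). 1)"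
      by (intro sum_mono order_trans[OF norm_le_l1_cart] theta_feasible_entry_bound[OF X])
    finally show "norm X \<le> (\<Sum>i\<in>(UNIV :: 'a set). \<Sum>j\<in>(UNIV :: 'a set). 1)" .
  qed
  ultimately show ?thesis by (simp add: compact_eq_bounded_closed)
qed

lemma lovasz_theta_attained:
  fixes E :: "'v::finite \<Rightarrow> 'v \<Rightarrow> bool"
  assumes "simple_graph E"
  obtains X where "X \<in> theta_feasible E" "trace (all_ones ** X) = lovasz_theta E"
    "\<And>Y. Y \<in> theta_feasible E \<Longrightarrow> trace (all_ones ** Y) \<le> lovasz_theta E"
proof -
  have "(mat (1 / real CARD('v)) :: real^'v^'v) \<in> theta_feasible E"
    using assms
    by (auto simp: theta_feasible_def pos_semidef_def sym_matrix_def simple_graph_def trace_def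
        mat_def transpose_def vec_eq_iff quad_form if_distrib if_distribR sum.delta cong: if_cong
        intro!: sum_nonneg)
  then have "theta_feasible E \<noteq> {}" by auto
  moreover have "continuous_on (theta_feasible E) (\<lambda>X. trace (all_ones ** X))"
    unfolding trace_def matrix_matrix_mult_def by (auto intro!: continuous_intros)
  ultimately obtain X where X: "X \<in> theta_feasible E"
    "\<And>Y. Y \<in> theta_feasible E \<Longrightarrow> trace (all_ones ** Y) \<le> trace (all_ones ** X)"
    using continuous_attains_sup[OF compact_theta_feasible] by metis
  have "lovasz_theta E = trace (all_ones ** X)"
    unfolding lovasz_theta_def using X by (intro cSup_eq_maximum) auto
  with X show ?thesis using that by simp
qed

end

theory Submission
  imports Defs
begin

text \<open>
  Upper bound. Let \<open>e\<^sub>1, \<dots>, e\<^sub>n\<close> be an orthonormal eigenbasis of \<open>Z\<close> with decreasing eigenvalues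
  \<open>l\<^sub>i\<close>, take an optimal colouring with \<open>k\<close> colours, and let \<open>u\<^sub>a\<close> be the normalised restriction of
  \<open>e\<^sub>1\<close> to the colour class \<open>a\<close>. Colour classes are independent, so
  \<open>0 = \<Sum>\<^sub>a u\<^sub>a \<bullet> Z u\<^sub>a = \<Sum>\<^sub>i l\<^sub>i w\<^sub>i\<close> with \<open>w\<^sub>i = \<Sum>\<^sub>a (u\<^sub>a \<bullet> e\<^sub>i)\<^sup>2\<close>. By Bessel's inequality
  \<open>0 \<le> w\<^sub>i \<le> 1\<close>; moreover \<open>w\<^sub>1 = 1\<close> and the weights sum to \<open>k\<close>, so the sum is at least \<open>l\<^sub>1\<close> plus
  the \<open>k - 1\<close> smallest eigenvalues.

  Lower bound. Write an optimal \<open>X\<close> as \<open>D (I + Z) D\<close>, where \<open>D\<^sup>2\<close> is the diagonal of \<open>X\<close> and \<open>Z\<close> is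
  supported on the edges. Positivity of \<open>X\<close> makes every eigenvalue of \<open>Z\<close> at least \<open>-1\<close>, and the
  entries of \<open>X\<close> sum to \<open>1 + d \<bullet> Z d \<le> 1 + l\<^sub>1\<close>, where the unit vector \<open>d\<close> is the diagonal of \<open>D\<close>.
  Hence \<open>\<vartheta> \<le> 1 + l\<^sub>1 \<le> 1 + (h - 1)\<close>.
\<close>

section \<open>Spectral theorem for self-adjoint maps\<close>

lemma inner_sym_matrix:
  assumes "sym_matrix M"
  shows "x \<bullet> (M *v y) = (M *v x) \<bullet> y"
  using assms by (metis dot_lmul_matrix vector_transpose_matrix sym_matrix_def)

text \<open>A maximiser \<open>x\<close> of the Rayleigh quotient on the unit sphere of
  \<open>S\<close> is an eigenvector: the residual \<open>r = f x - \<mu> x\<close> lies in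
  \<open>S\<close> and is orthogonal to \<open>x\<close>, so if it were nonzero, a small move from
  \<open>x\<close> along \<open>r\<close> would raise the quotient to first order.\<close>

lemma selfadjoint_eigenvector_in_subspace:
  fixes f :: "'a::euclidean_space \<Rightarrow> 'a"
  assumes "linear f" and sa: "\<And>x y. x \<bullet> f y = f x \<bullet> y"
    and S: "subspace S" and inv: "\<And>x. x \<in> S \<Longrightarrow> f x \<in> S"
    and nz: "z \<in> S" "z \<noteq> 0"
  obtains x \<mu> where "x \<in> S" "norm x = 1" "f x = \<mu> *\<^sub>R x"
proof -
  interpret linear f by fact
  define K where "K = S \<inter> sphere 0 1"
  have "compact K"
    unfolding K_def using closed_subspace[OF S] by (simp add: closed_Int_compact)
  moreover have "z /\<^sub>R norm z \<in> K"
    using nz S by (simp add: K_def subspace_scale)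
  moreover have "continuous_on K (\<lambda>x. x \<bullet> f x)"
    by (intro continuous_intros linear_continuous_on) (simp add: linear_conv_bounded_linear[symmetric] linear_axioms)
  ultimately obtain x where x: "x \<in> K" and max: "\<And>y. y \<in> K \<Longrightarrow> y \<bullet> f y \<le> x \<bullet> f x"
    using continuous_attains_sup[of K "\<lambda>x. x \<bullet> f x"] by blast
  define \<mu> where "\<mu> = x \<bullet> f x"
  have xS: "x \<in> S" and x1: "norm x = 1" using x by (auto simp: K_def)
  have rayleigh: "y \<bullet> f y \<le> \<mu> * (y \<bullet> y)" if "y \<in> S" for y
  proof (cases "y = 0")
    case False
    have "y /\<^sub>R norm y \<in> K" using that False S by (simp add: K_def subspace_scale)
    from max[OF this] have "(y \<bullet> f y) / (norm y)^2 \<le> \<mu>"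
      by (simp add: scale \<mu>_def divide_inverse power2_eq_square mult_ac)
    then show ?thesis using False by (simp add: power2_norm_eq_inner divide_le_eq)
  qed (simp add: zero)
  define r where "r = f x - \<mu> *\<^sub>R x"
  have rS: "r \<in> S" using S inv xS by (simp add: r_def subspace_diff subspace_scale)
  have xx: "x \<bullet> x = 1" using x1 by (simp add: norm_eq_1)
  have xr: "x \<bullet> r = 0" by (simp add: r_def inner_diff_right \<mu>_def xx)
  have rfx: "r \<bullet> f x = r \<bullet> r"
    using xr by (simp add: r_def inner_diff_right inner_diff_left inner_commute)
  have ineq: "2 * t * (r \<bullet> r) \<le> t^2 * (\<mu> * (r \<bullet> r) - r \<bullet> f r)" for t
  proof -
    have "x + t *\<^sub>R r \<in> S" using S xS rS by (simp add: subspace_add subspace_scale)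
    from rayleigh[OF this] have "\<mu> + 2 * t * (r \<bullet> f x) + t^2 * (r \<bullet> f r) \<le> \<mu> * (1 + t^2 * (r \<bullet> r))"
      using xr xx sa[of x r]
      by (simp add: add scale inner_add_left inner_add_right \<mu>_def inner_commute power2_eq_square algebra_simps)
    then show ?thesis by (simp add: rfx algebra_simps)
  qed
  define a where "a = r \<bullet> r"
  define b where "b = \<mu> * (r \<bullet> r) - r \<bullet> f r"
  have "a \<le> 0"
  proof (rule ccontr)
    assume "\<not> a \<le> 0"
    \<comment> \<open>This \<open>t\<close> is small enough for the second-order term to lose:
      \<open>t * b \<le> a\<close>, whereas \<open>ineq\<close> demands
      \<open>2 * a \<le> t * b\<close>. The added 1 keeps the denominator positive.\<close>
    define t where "t = a / (\<bar>b\<bar> + 1)"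
    have t: "t > 0" using \<open>\<not> a \<le> 0\<close> by (simp add: t_def)
    have "t * (2 * a) \<le> t * (t * b)" using ineq[of t] by (simp add: a_def b_def power2_eq_square mult_ac)
    then have "2 * a \<le> t * b" using t by simp
    also have "\<dots> \<le> t * (\<bar>b\<bar> + 1)" using t by (intro mult_left_mono) auto
    also have "\<dots> = a" by (simp add: t_def)
    finally show False using \<open>\<not> a \<le> 0\<close> by simp
  qed
  then have "r = 0" using inner_ge_zero[of r] by (simp add: a_def)
  then show ?thesis using that xS x1 by (simp add: r_def)
qed

text \<open>Induction on \<open>k\<close>: the orthogonal complement of the eigenvectors found so
  far is invariant because \<open>f\<close> is self-adjoint, and it is nonzero while fewer than
  \<open>DIM('a)\<close> have been found, so it contains another eigenvector.\<close>

lemma selfadjoint_orthonormal_eigenvectors: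
  fixes f :: "'a::euclidean_space \<Rightarrow> 'a"
  assumes "linear f" and sa: "\<And>x y. x \<bullet> f y = f x \<bullet> y"
    and "k \<le> DIM('a)"
  shows "\<exists>B. finite B \<and> card B = k \<and> pairwise orthogonal B \<and> (\<forall>b\<in>B. norm b = 1 \<and> (\<exists>\<mu>. f b = \<mu> *\<^sub>R b))"
  using \<open>k \<le> DIM('a)\<close>
proof (induction k)
  case 0
  show ?case by (rule exI[of _ "{}"]) simp
next
  case (Suc k)
  then obtain B where B: "finite B" "card B = k" "pairwise orthogonal B"
    "\<forall>b\<in>B. norm b = 1 \<and> (\<exists>\<mu>. f b = \<mu> *\<^sub>R b)" by auto
  define S where "S = {y. \<forall>b\<in>B. orthogonal b y}"
  have "dim (span B) < DIM('a)"
    using dim_le_card'[OF B(1)] B(2) Suc.prems by simp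
  from orthogonal_to_subspace_exists[of B] this obtain z where "z \<noteq> 0" "\<And>y. y \<in> span B \<Longrightarrow> orthogonal z y"
    by auto
  then have z: "z \<noteq> 0" "z \<in> S" by (auto simp: S_def orthogonal_commute span_base)
  have "subspace S" unfolding S_def by (rule subspace_orthogonal_to_vectors)
  moreover have "f x \<in> S" if "x \<in> S" for x
  proof -
    have "orthogonal b (f x)" if "b \<in> B" for b
    proof -
      obtain \<mu> where "f b = \<mu> *\<^sub>R b" using B \<open>b \<in> B\<close> by auto
      then show ?thesis using \<open>x \<in> S\<close> \<open>b \<in> B\<close> by (simp add: S_def orthogonal_def sa)
    qed
    then show ?thesis by (simp add: S_def)
  qed
  ultimately obtain x \<mu> where x: "x \<in> S" "norm x = 1" "f x = \<mu> *\<^sub>R x"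
    using selfadjoint_eigenvector_in_subspace[OF assms(1) sa, of S z] z by metis
  have "x \<notin> B" using x by (auto simp: S_def orthogonal_def norm_eq_1)
  then show ?case using B x
    by (intro exI[of _ "insert x B"]) (auto simp: pairwise_insert S_def orthogonal_commute)
qed

section \<open>Characteristic polynomials and diagonalisation\<close>

lemma const_poly_sum: "[:\<Sum>x\<in>A. f x:] = (\<Sum>x\<in>A. [:f x:])" for f :: "'a \<Rightarrow> 'b::comm_monoid_add"
proof (induction A rule: infinite_finite_induct)
  case (insert x F)
  have "[:f x + sum f F:] = [:f x:] + [:sum f F:]" by simp
  then show ?case using insert by simp
qed simp_all

lemma map_matrix_const_poly_mult:
  fixes A B :: "real^'n^'n"
  shows "map_matrix (\<lambda>a. [:a:]) (A ** B) = map_matrix (\<lambda>a. [:a:]) A ** map_matrix (\<lambda>a. [:a:]) B"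
  by (simp add: vec_eq_iff matrix_matrix_mult_def const_poly_sum mult.commute)

lemma matrix_diff_distrib:
  fixes A B C :: "'a::comm_ring_1^'n^'n"
  shows "(A - B) ** C = A ** C - B ** C" "C ** (A - B) = C ** A - C ** B"
  by (simp_all add: vec_eq_iff matrix_matrix_mult_def algebra_simps sum_subtractf)

lemma mat_scalar_commute:
  fixes A :: "'a::comm_ring_1^'n^'n"
  shows "mat c ** A = A ** mat c"
  by (simp add: vec_eq_iff matrix_matrix_mult_def mat_def if_distrib if_distribR mult.commute cong: if_cong)

text \<open>Over the polynomial ring, \<open>P\<close> also intertwines \<open>x I - M\<close> with
  \<open>x I - D\<close>. Taking determinants, the factor \<open>det P\<close> is a nonzero
  polynomial by \<open>QP\<close> and cancels in an integral domain.\<close>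

lemma characteristic_poly_similar:
  fixes M D P Q :: "real^'n^'n"
  assumes QP: "Q ** P = mat 1" and MP: "M ** P = P ** D"
  shows "characteristic_poly M = characteristic_poly D"
proof -
  let ?C = "map_matrix (\<lambda>a::real. [:a:]) :: real^'n^'n \<Rightarrow> real poly^'n^'n"
  have "?C Q ** ?C P = mat 1"
    unfolding map_matrix_const_poly_mult[symmetric] QP by (simp add: vec_eq_iff mat_def)
  then have "det (?C Q) * det (?C P) = 1" by (metis det_I det_mul)
  then have nz: "det (?C P) \<noteq> 0" by auto
  have "(mat [:0, 1:] - ?C M) ** ?C P = ?C P ** (mat [:0, 1:] - ?C D)"
    by (simp add: matrix_diff_distrib mat_scalar_commute MP flip: map_matrix_const_poly_mult)
  then have "det (mat [:0, 1:] - ?C M) * det (?C P) = det (?C P) * det (mat [:0, 1:] - ?C D)"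
    by (metis det_mul)
  then show ?thesis using nz by (simp add: characteristic_poly_def)
qed

lemma proots_characteristic_poly_diagonal:
  fixes d :: "'n::finite \<Rightarrow> real"
  shows "proots (characteristic_poly (\<chi> i j. if i = j then d i else 0)) = image_mset d (mset_set UNIV)"
proof -
  have "characteristic_poly (\<chi> i j. if i = j then d i else 0) = (\<Prod>i\<in>UNIV. [:- d i, 1:])"
    unfolding characteristic_poly_def by (subst det_diagonal) (auto simp: mat_def)
  moreover have "proots (\<Prod>i\<in>UNIV. [:- d i, 1:]) = (\<Sum>i\<in>UNIV. {#d i#})"
    by (subst proots_prod) auto
  moreover have "(\<Sum>i\<in>A. {#d i#}) = image_mset d (mset_set A)" if "finite A" for A
    using that by induction auto
  ultimately show ?thesis by simp
qed

text \<open>This ties the roots of the characteristic polynomial, through which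
  \<open>eigval\<close> is defined, to eigenvectors. Indexing the basis by \<open>'n\<close> lets it
  serve as the columns of a square matrix.\<close>

lemma sym_matrix_diagonalization:
  fixes M :: "real^'n^'n"
  assumes "sym_matrix M"
  obtains v d where "\<And>i j. v i \<bullet> v j = (if i = j then 1 else 0)" "\<And>i. M *v v i = d i *\<^sub>R v i"
    "proots (characteristic_poly M) = image_mset d (mset_set (UNIV :: 'n set))"
proof -
  have "linear ((*v) M)" by simp
  from selfadjoint_orthonormal_eigenvectors[OF this inner_sym_matrix[OF assms], of "CARD('n)"]
  obtain B where B: "finite B" "card B = CARD('n)" "pairwise orthogonal B"
    "\<forall>b\<in>B. norm b = 1 \<and> (\<exists>\<mu>. M *v b = \<mu> *\<^sub>R b)" by auto
  obtain v :: "'n \<Rightarrow> real^'n" where v: "bij_betw v UNIV B"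
    using finite_same_card_bij[of "UNIV::'n set" B] B by auto
  have vB: "v i \<in> B" for i using bij_betwE[OF v] by simp
  have nm: "norm (v i) = 1" and "\<exists>\<mu>. M *v v i = \<mu> *\<^sub>R v i" for i using B(4) vB[of i] by auto
  then obtain d where d: "\<And>i. M *v v i = d i *\<^sub>R v i" by metis
  have on: "v i \<bullet> v j = (if i = j then 1 else 0)" for i j
  proof (cases "i = j")
    case True
    then show ?thesis using nm[of i] by (simp add: norm_eq_1)
  next
    case False
    then have "v i \<noteq> v j" using v by (auto simp: bij_betw_def inj_on_def)
    with B(3) vB[of i] vB[of j] have "orthogonal (v i) (v j)" unfolding pairwise_def by blast
    then show ?thesis using False by (simp add: orthogonal_def)
  qed
  \<comment> \<open>With the eigenvectors as columns, orthonormality reads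
    \<open>transpose P ** P = mat 1\<close> and the eigenvalue equations read
    \<open>M ** P = P ** D\<close> with \<open>D\<close> diagonal.\<close>
  define P :: "real^'n^'n" where "P = (\<chi> i j. v j $ i)"
  have "transpose P ** P = mat 1"
    using on by (simp add: vec_eq_iff matrix_matrix_mult_def transpose_def P_def mat_def inner_vec_def)
  moreover have "M ** P = P ** (\<chi> i j. if i = j then d i else 0)"
    using d by (simp add: vec_eq_iff matrix_matrix_mult_def matrix_vector_mult_def P_def
        if_distrib if_distribR mult.commute cong: if_cong)
  ultimately have "characteristic_poly M = characteristic_poly (\<chi> i j. if i = j then d i else 0)"
    by (rule characteristic_poly_similar)
  then have "proots (characteristic_poly M) = image_mset d (mset_set UNIV)"
    by (simp only: proots_characteristic_poly_diagonal)
  then show ?thesis using that on d by blast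
qed

section \<open>Eigenbases listed by decreasing eigenvalue\<close>

lemma orthonormal_family_expand:
  fixes e :: "nat \<Rightarrow> 'a::euclidean_space"
  assumes on: "\<And>i j. i \<in> {1..DIM('a)} \<Longrightarrow> j \<in> {1..DIM('a)} \<Longrightarrow> e i \<bullet> e j = (if i = j then 1 else 0)"
  shows "(\<Sum>i=1..DIM('a). (x \<bullet> e i) *\<^sub>R e i) = x"
proof -
  let ?I = "{1..DIM('a)}"
  have inj: "inj_on e ?I"
    by (rule inj_onI) (metis on zero_neq_one)
  have pw: "pairwise orthogonal (e ` ?I)"
    by (auto simp: pairwise_def orthogonal_def on)
  have nm: "norm b = 1" if "b \<in> e ` ?I" for b
    using that by (auto simp: norm_eq_1 on)
  have "independent (e ` ?I)"
    using pw nm by (intro pairwise_orthogonal_independent) force+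
  then have "UNIV \<subseteq> span (e ` ?I)"
    using inj by (intro card_ge_dim_independent) (auto simp: card_image)
  then have "(\<Sum>b\<in>e ` ?I. (x \<bullet> b) *\<^sub>R b) = x"
    using pw nm by (intro orthonormal_basis_expand) auto
  then show ?thesis unfolding sum.reindex[OF inj] by simp
qed

lemma orthonormal_eigenbasis_quadratic_form:
  fixes M :: "real^'n^'n"
  assumes on: "\<And>i j. i \<in> {1..CARD('n)} \<Longrightarrow> j \<in> {1..CARD('n)} \<Longrightarrow> e i \<bullet> e j = (if i = j then 1 else 0)"
    and eig: "\<And>i. i \<in> {1..CARD('n)} \<Longrightarrow> M *v e i = l i *\<^sub>R e i"
  shows "x \<bullet> x = (\<Sum>i=1..CARD('n). (x \<bullet> e i)\<^sup>2)"
    and "x \<bullet> (M *v x) = (\<Sum>i=1..CARD('n). l i * (x \<bullet> e i)\<^sup>2)"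
proof -
  have exp: "x = (\<Sum>i=1..CARD('n). (x \<bullet> e i) *\<^sub>R e i)"
    using orthonormal_family_expand[of e x] on by simp
  have "x \<bullet> x = x \<bullet> (\<Sum>i=1..CARD('n). (x \<bullet> e i) *\<^sub>R e i)" using exp by simp
  then show "x \<bullet> x = (\<Sum>i=1..CARD('n). (x \<bullet> e i)\<^sup>2)"
    by (simp add: inner_sum_right power2_eq_square)
  have "M *v x = M *v (\<Sum>i=1..CARD('n). (x \<bullet> e i) *\<^sub>R e i)" using exp by simp
  also have "\<dots> = (\<Sum>i=1..CARD('n). (x \<bullet> e i) *\<^sub>R (l i *\<^sub>R e i))"
    by (simp add: linear_sum[OF matrix_vector_mul_linear] o_def matrix_vector_mult_scaleR eig)
  finally show "x \<bullet> (M *v x) = (\<Sum>i=1..CARD('n). l i * (x \<bullet> e i)\<^sup>2)"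
    by (simp add: inner_sum_right power2_eq_square mult_ac)
qed

text \<open>Both bounds access \<open>eigval\<close> only through this lemma: in the basis
  \<open>e\<close>, a quadratic form is a sum of eigenvalues weighted by squared
  coordinates.\<close>

lemma sym_matrix_eigval_basis:
  fixes M :: "real^'n^'n"
  assumes "sym_matrix M"
  obtains e where "\<And>i. i \<in> {1..CARD('n)} \<Longrightarrow> e i \<bullet> e i = 1"
    "\<And>i. i \<in> {1..CARD('n)} \<Longrightarrow> M *v e i = eigval i M *\<^sub>R e i"
    "\<And>i j. 1 \<le> i \<Longrightarrow> i \<le> j \<Longrightarrow> j \<le> CARD('n) \<Longrightarrow> eigval j M \<le> eigval i M"
    "\<And>x. x \<bullet> x = (\<Sum>i=1..CARD('n). (x \<bullet> e i)\<^sup>2)"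
    "\<And>x. x \<bullet> (M *v x) = (\<Sum>i=1..CARD('n). eigval i M * (x \<bullet> e i)\<^sup>2)"
proof -
  obtain v d where v: "\<And>i j. v i \<bullet> v j = (if i = j then 1 else 0)" "\<And>i. M *v v i = d i *\<^sub>R v i"
    "proots (characteristic_poly M) = image_mset d (mset_set (UNIV :: 'n set))"
    using sym_matrix_diagonalization[OF assms] by metis
  obtain us :: "'n list" where us: "set us = UNIV" "distinct us"
    using finite_distinct_list[of "UNIV :: 'n set"] by auto
  \<comment> \<open>Sorting the indices by \<open>d\<close>, rather than the eigenvalues themselves,
    keeps each eigenvector attached to its eigenvalue even when eigenvalues repeat. The reversal
    makes the order decreasing.\<close>
  define ys where "ys = rev (sort_key d us)"
  have ys: "distinct ys" "length ys = CARD('n)"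
    using us by (simp_all add: ys_def) (metis distinct_card)
  have "mset (map d (sort_key d us)) = image_mset d (mset_set UNIV)"
    using us by (simp add: mset_set_set[symmetric])
  then have "sorted_list_of_multiset (proots (characteristic_poly M)) = map d (sort_key d us)"
    unfolding v(3) by (metis sorted_list_of_multiset_mset sorted_sort_id sorted_sort_key)
  then have "eigval k M = map d ys ! (k - 1)" for k
    by (simp add: eigval_def rev_map ys_def)
  then have eigval: "eigval k M = d (ys ! (k - 1))" if "k \<in> {1..CARD('n)}" for k
  proof -
    have "k - 1 < length ys" using that ys(2) by auto
    then show ?thesis by (simp add: \<open>eigval k M = map d ys ! (k - 1)\<close>)
  qed
  define e where "e k = v (ys ! (k - 1))" for k
  have on: "e i \<bullet> e j = (if i = j then 1 else 0)" if "i \<in> {1..CARD('n)}" "j \<in> {1..CARD('n)}" for i j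
  proof -
    have "ys ! (i - 1) = ys ! (j - 1) \<longleftrightarrow> i = j"
      using ys that by (subst nth_eq_iff_index_eq) auto
    then show ?thesis by (simp add: v e_def)
  qed
  have eig: "M *v e i = eigval i M *\<^sub>R e i" if "i \<in> {1..CARD('n)}" for i
    using that by (simp add: v eigval e_def)
  have mono: "eigval j M \<le> eigval i M" if "1 \<le> i" "i \<le> j" "j \<le> CARD('n)" for i j
  proof -
    have "sorted (rev (map d ys))" by (simp add: ys_def rev_map)
    then have "map d ys ! (j - 1) \<le> map d ys ! (i - 1)"
      using that ys by (intro sorted_rev_nth_mono) auto
    then show ?thesis using that ys by (simp add: eigval)
  qed
  have "x \<bullet> x = (\<Sum>i=1..CARD('n). (x \<bullet> e i)\<^sup>2)"
    and "x \<bullet> (M *v x) = (\<Sum>i=1..CARD('n). eigval i M * (x \<bullet> e i)\<^sup>2)" for x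
    by (rule orthonormal_eigenbasis_quadratic_form[where M = M]; use on eig in blast)+
  moreover have "e i \<bullet> e i = 1" if "i \<in> {1..CARD('n)}" for i using on[OF that that] by simp
  ultimately show ?thesis using that[of e] eig mono by blast
qed

section \<open>Upper bound by the chromatic number\<close>

lemma sum_smallest_le_weighted_sum:
  fixes l w :: "'a \<Rightarrow> real"
  assumes "finite I" "T \<subseteq> I"
    and w: "\<And>i. i \<in> I \<Longrightarrow> 0 \<le> w i" "\<And>i. i \<in> I \<Longrightarrow> w i \<le> 1" "sum w I = real (card T)"
    and t: "\<And>i. i \<in> T \<Longrightarrow> l i \<le> t" "\<And>i. i \<in> I - T \<Longrightarrow> t \<le> l i"
  shows "sum l T \<le> (\<Sum>i\<in>I. l i * w i)"
proof -
  \<comment> \<open>After the shift by \<open>t\<close> the terms on \<open>T\<close> are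
    nonpositive, so weights at most 1 can only raise them, and those off \<open>T\<close> are
    nonnegative. The shift cancels at the end, since both sides have total weight
    \<open>card T\<close>.\<close>
  have "(\<Sum>i\<in>T. l i - t) \<le> (\<Sum>i\<in>T. (l i - t) * w i)"
    using w t \<open>T \<subseteq> I\<close> by (intro sum_mono) (force simp: mult_le_cancel_left1)
  also have "\<dots> \<le> (\<Sum>i\<in>T. (l i - t) * w i) + (\<Sum>i\<in>I - T. (l i - t) * w i)"
    using w t by (auto intro!: sum_nonneg)
  also have "\<dots> = (\<Sum>i\<in>I. (l i - t) * w i)"
    using assms(1,2) by (metis add.commute sum.subset_diff)
  also have "\<dots> = (\<Sum>i\<in>I. l i * w i) - t * sum w I"
    by (simp add: left_diff_distrib sum_subtractf sum_distrib_left)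
  finally show ?thesis using w(3) by (simp add: sum_subtractf mult.commute)
qed

lemma colorable_chromatic_number:
  fixes E :: "'v::finite \<Rightarrow> 'v \<Rightarrow> bool"
  assumes "simple_graph E"
  shows "colorable E (chromatic_number E)" "chromatic_number E \<le> CARD('v)"
proof -
  obtain c :: "'v \<Rightarrow> nat" where c: "bij_betw c UNIV {..<CARD('v)}"
    using finite_same_card_bij[of "UNIV::'v set" "{..<CARD('v)}"] by auto
  have "colorable E CARD('v)"
    unfolding colorable_def using assms c
    by (intro exI[of _ c]) (auto simp: simple_graph_def bij_betw_def inj_on_def, metis)
  then show "colorable E (chromatic_number E)" "chromatic_number E \<le> CARD('v)"
    unfolding chromatic_number_def by (auto intro: LeastI Least_le)
qed

text \<open>In an optimal colouring every colour occurs: if \<open>a\<close> were missing, the class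
  of the last colour \<open>k - 1\<close> could be recoloured with \<open>a\<close>, saving one
  colour.\<close>

lemma chromatic_number_surj_coloring:
  fixes E :: "'v::finite \<Rightarrow> 'v \<Rightarrow> bool"
  assumes "simple_graph E"
  obtains c where "range c = {..<chromatic_number E}" "\<And>u v. E u v \<Longrightarrow> c u \<noteq> c v"
proof -
  define k where "k = chromatic_number E"
  obtain c where c: "\<And>v. c v < k" "\<And>u v. E u v \<Longrightarrow> c u \<noteq> c v"
    using colorable_chromatic_number(1)[OF assms] by (auto simp: colorable_def k_def)
  have "\<exists>v. c v = a" if "a < k" for a
  proof (rule ccontr)
    assume "\<nexists>v. c v = a"
    then have na: "c v \<noteq> a" for v by blast
    define c' where "c' v = (if c v = k - 1 then a else c v)" for v
    have "a \<noteq> k - 1" if "c v = k - 1" for v using na[of v] that by auto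
    then have "c' v < k - 1" for v
      using c(1)[of v] \<open>a < k\<close> by (fastforce simp: c'_def)
    moreover have "c' u \<noteq> c' v" if "E u v" for u v
      using c(2)[OF that] na[of u] na[of v] by (auto simp: c'_def)
    ultimately have "colorable E (k - 1)" unfolding colorable_def by blast
    then have "k \<le> k - 1" unfolding k_def chromatic_number_def by (rule Least_le)
    then show False using that by simp
  qed
  then have "range c = {..<k}" using c by force
  then show ?thesis using that c k_def by blast
qed

text \<open>The condition minimised in \<open>h_number\<close>, named so that it can be proved of
  one \<open>m\<close> and used for another.\<close>

definition h_admissible :: "('v::finite \<Rightarrow> 'v \<Rightarrow> bool) \<Rightarrow> nat \<Rightarrow> bool" where
  "h_admissible E m \<longleftrightarrow> 1 \<le> m \<and>
     (\<forall>Z. supported_on E Z \<longrightarrow>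
        eigval 1 Z + (\<Sum>i = 1..m - 1. eigval (CARD('v) + 1 - i) Z) \<le> 0)"

text \<open>The \<open>u a\<close> have disjoint supports and unit length, so the last property is
  Bessel's inequality, obtained from Cauchy-Schwarz on each class. Equality holds at
  \<open>x\<close> because its restriction to each class is a multiple of \<open>u a\<close>.
  Surjectivity onto the colours supplies a vertex in every class.\<close>

lemma coloring_test_vectors:
  fixes c :: "'v::finite \<Rightarrow> nat" and x :: "real^'v"
  assumes c: "range c = {..<k}"
  obtains u :: "nat \<Rightarrow> real^'v" where "\<And>a. a < k \<Longrightarrow> u a \<bullet> u a = 1"
    "\<And>a v. a < k \<Longrightarrow> c v \<noteq> a \<Longrightarrow> u a $ v = 0"
    "(\<Sum>a<k. (u a \<bullet> x)\<^sup>2) = x \<bullet> x"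
    "\<And>y. (\<Sum>a<k. (u a \<bullet> y)\<^sup>2) \<le> y \<bullet> y"
proof -
  define R where "R a y = (\<chi> v. if c v = a then y $ v else 0)" for a and y :: "real^'v"
  (* In a class on which x vanishes any unit vector supported there will do. *)
  define u where "u a = (if R a x = 0 then axis (SOME v. c v = a) 1 else R a x /\<^sub>R norm (R a x))" for a
  have sm: "c (SOME v. c v = a) = a" if "a < k" for a
  proof -
    have "\<exists>v. c v = a" using c that by (metis imageE lessThan_iff)
    then show ?thesis by (rule someI_ex)
  qed
  have supp: "u a $ v = 0" if "a < k" "c v \<noteq> a" for a v
    using that sm[of a] by (auto simp: u_def R_def axis_def)
  have unit: "norm (u a) = 1" for a
    by (simp add: u_def)
  have RR: "z \<bullet> y = z \<bullet> R a y" if "\<And>v. c v \<noteq> a \<Longrightarrow> z $ v = 0" for z y a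
    unfolding inner_vec_def by (intro sum.cong) (auto simp: R_def that)
  have tot: "(\<Sum>a<k. (norm (R a y))\<^sup>2) = y \<bullet> y" for y
  proof -
    have "(\<Sum>a<k. (norm (R a y))\<^sup>2) = (\<Sum>a<k. \<Sum>v\<in>UNIV. if c v = a then (y $ v)\<^sup>2 else 0)"
      unfolding power2_norm_eq_inner inner_vec_def
      by (intro sum.cong refl) (simp add: R_def power2_eq_square)
    also have "\<dots> = (\<Sum>v\<in>UNIV. \<Sum>a<k. if c v = a then (y $ v)\<^sup>2 else 0)" by (rule sum.swap)
    also have "\<dots> = (\<Sum>v\<in>UNIV. (y $ v)\<^sup>2)"
      using c by (intro sum.cong refl) (auto simp: sum.delta')
    finally show ?thesis by (simp add: inner_vec_def power2_eq_square)
  qed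
  have "(u a \<bullet> x)\<^sup>2 = (norm (R a x))\<^sup>2" if "a < k" for a
  proof (cases "R a x = 0")
    case True
    then show ?thesis using RR[of a "u a" x] supp that by simp
  next
    case False
    have "u a \<bullet> x = u a \<bullet> R a x" using RR[of a "u a" x] supp that by simp
    also have "\<dots> = norm (R a x)" using False by (simp add: u_def dot_square_norm power2_eq_square)
    finally show ?thesis by simp
  qed
  then have eq: "(\<Sum>a<k. (u a \<bullet> x)\<^sup>2) = x \<bullet> x" using tot[of x] by simp
  have "(\<Sum>a<k. (u a \<bullet> y)\<^sup>2) \<le> y \<bullet> y" for y
  proof -
    have "(u a \<bullet> y)\<^sup>2 \<le> (norm (R a y))\<^sup>2" if "a < k" for a
      using RR[of a "u a" y] supp that Cauchy_Schwarz_ineq2[of "u a" "R a y"] unit[of a]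
      by (simp add: abs_le_square_iff[symmetric])
    then show ?thesis using tot[of y] by (metis (no_types, lifting) lessThan_iff sum_mono)
  qed
  then show ?thesis using that[of u] unit supp eq by (simp add: norm_eq_1)
qed

lemma h_admissible_chromatic_number:
  fixes E :: "'v::finite \<Rightarrow> 'v \<Rightarrow> bool"
  assumes G: "simple_graph E"
  shows "h_admissible E (chromatic_number E)"
proof -
  define k where "k = chromatic_number E"
  define n where "n = CARD('v)"
  obtain c where c: "range c = {..<k}" "\<And>u v. E u v \<Longrightarrow> c u \<noteq> c v"
    using chromatic_number_surj_coloring[OF G] k_def by metis
  have k1: "1 \<le> k" using c(1) by (cases k) auto
  have kn: "k \<le> n" using colorable_chromatic_number(2)[OF G] by (simp add: k_def n_def)
  have "eigval 1 Z + (\<Sum>i = 1..k - 1. eigval (n + 1 - i) Z) \<le> 0" if Z: "supported_on E Z" for Z :: "real^'v^'v"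
  proof -
    have "sym_matrix Z" using Z by (simp add: supported_on_def)
    then obtain e where on: "\<And>i. i \<in> {1..n} \<Longrightarrow> e i \<bullet> e i = 1"
      and "\<And>i. i \<in> {1..n} \<Longrightarrow> Z *v e i = eigval i Z *\<^sub>R e i"
      and mono: "\<And>i j. 1 \<le> i \<Longrightarrow> i \<le> j \<Longrightarrow> j \<le> n \<Longrightarrow> eigval j Z \<le> eigval i Z"
      and qf: "\<And>x. x \<bullet> x = (\<Sum>i=1..n. (x \<bullet> e i)\<^sup>2)"
        "\<And>x. x \<bullet> (Z *v x) = (\<Sum>i=1..n. eigval i Z * (x \<bullet> e i)\<^sup>2)"
      using sym_matrix_eigval_basis[of Z, folded n_def] by blast
    obtain u :: "nat \<Rightarrow> real^'v" where u: "\<And>a. a < k \<Longrightarrow> u a \<bullet> u a = 1"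
      "\<And>a v. a < k \<Longrightarrow> c v \<noteq> a \<Longrightarrow> u a $ v = 0"
      "(\<Sum>a<k. (u a \<bullet> e 1)\<^sup>2) = e 1 \<bullet> e 1"
      "\<And>y. (\<Sum>a<k. (u a \<bullet> y)\<^sup>2) \<le> y \<bullet> y"
      using coloring_test_vectors[OF c(1), of "e 1"] by metis
    define w where "w i = (\<Sum>a<k. (u a \<bullet> e i)\<^sup>2)" for i
    have w1: "w 1 = 1" using u(3) on[of 1] k1 kn by (simp add: w_def)
    have w: "0 \<le> w i" "w i \<le> 1" if "i \<in> {1..n}" for i
      using u(4)[of "e i"] on[OF that] by (simp_all add: w_def sum_nonneg)
    have zero: "u a \<bullet> (Z *v u a) = 0" if "a < k" for a
    proof -
      \<comment> \<open>The ends of an edge have different colours, so one of them lies outside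
        class \<open>a\<close>; at a non-edge, diagonal included, \<open>Z\<close> vanishes.\<close>
      have "u a $ i * (Z $ i $ j * u a $ j) = 0" for i j
        using c(2)[of i j] u(2)[OF that, of i] u(2)[OF that, of j] Z
        by (cases "E i j") (force simp: supported_on_def)+
      then show ?thesis unfolding quad_form by (simp add: sum.neutral)
    qed
    have "(\<Sum>i=1..n. w i) = (\<Sum>a<k. u a \<bullet> u a)"
      unfolding w_def qf(1)[of "u _"] by (rule sum.swap)
    then have sw: "(\<Sum>i=1..n. w i) = k" using u(1) by simp
    have "(\<Sum>i=1..n. eigval i Z * w i) = (\<Sum>a<k. u a \<bullet> (Z *v u a))"
      unfolding w_def qf(2)[of "u _"] sum_distrib_left by (rule sum.swap)
    then have sl: "(\<Sum>i=1..n. eigval i Z * w i) = 0" using zero by simp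
    have split: "(\<Sum>i=1..n. f i) = f 1 + (\<Sum>i=2..n. f i)" for f :: "nat \<Rightarrow> real"
      using k1 kn by (simp add: sum.atLeast_Suc_atMost numeral_2_eq_2)
    \<comment> \<open>The positions of the \<open>k - 1\<close> smallest eigenvalues. Since
      \<open>k \<le> n\<close>, position 1 is not among them.\<close>
    define T where "T = {n + 2 - k..n}"
    have "(\<Sum>i\<in>T. eigval i Z) \<le> (\<Sum>i=2..n. eigval i Z * w i)"
    \<comment> \<open>The threshold is the largest eigenvalue at a position in \<open>T\<close>. For
      \<open>k = 1\<close> the set \<open>T\<close> is empty and \<open>n + 2 - k\<close> would be
      \<open>n + 1\<close>, hence the \<open>min\<close>.\<close>
    proof (rule sum_smallest_le_weighted_sum[where t = "eigval (min n (n + 2 - k)) Z"])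
      show "sum w {2..n} = real (card T)"
        using sw[unfolded split] w1 k1 kn by (simp add: T_def of_nat_diff)
    qed (use w mono k1 kn in \<open>auto simp: T_def\<close>)
    moreover have "(\<Sum>i\<in>T. eigval i Z) = (\<Sum>i = 1..k - 1. eigval (n + 1 - i) Z)"
      unfolding T_def using k1 kn
      by (intro sum.reindex_bij_witness[of _ "\<lambda>i. n + 1 - i" "\<lambda>i. n + 1 - i"]) auto
    ultimately show ?thesis using sl[unfolded split] w1 by simp
  qed
  then show ?thesis using k1 by (simp add: h_admissible_def k_def n_def)
qed

section \<open>Lower bound by the theta number\<close>

lemma pos_semidef_zero_diagonal:
  fixes X :: "real^'v::finite^'v"
  assumes X: "pos_semidef X" and "X $ i $ i = 0"
  shows "X $ i $ j = 0"
proof (rule ccontr)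
  assume nz: "X $ i $ j \<noteq> 0"
  have "transpose X $ i $ j = X $ i $ j" using X by (simp add: pos_semidef_def sym_matrix_def)
  then have sym: "X $ j $ i = X $ i $ j" by (simp add: transpose_def)
  have ent: "axis a 1 \<bullet> (X *v axis b 1) = X $ a $ b" for a b
    by (simp add: inner_axis' matrix_vector_mul_component inner_axis)
  \<comment> \<open>As \<open>X $ i $ i = 0\<close>, the quadratic form at
    \<open>axis j 1 + t *\<^sub>R axis i 1\<close> is affine in \<open>t\<close> with nonzero slope;
    this \<open>t\<close> gives it the value -1.\<close>
  define t where "t = - (X $ j $ j + 1) / (2 * X $ i $ j)"
  have "0 \<le> (axis j 1 + t *\<^sub>R axis i 1) \<bullet> (X *v (axis j 1 + t *\<^sub>R axis i 1))"
    using X by (simp add: pos_semidef_def)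
  also have "\<dots> = X $ j $ j + 2 * t * X $ i $ j"
    using sym assms(2)
    by (simp add: matrix_vector_right_distrib matrix_vector_mult_scaleR inner_add_left inner_add_right ent)
  also have "\<dots> = - 1" using nz by (simp add: t_def field_simps)
  finally show False by simp
qed

lemma lovasz_theta_le_h_admissible:
  fixes E :: "'v::finite \<Rightarrow> 'v \<Rightarrow> bool"
  assumes G: "simple_graph E" and m: "h_admissible E m" "m \<le> CARD('v)"
  shows "lovasz_theta (complement_graph E) \<le> real m"
proof -
  define n where "n = CARD('v)"
  have "simple_graph (complement_graph E)"
    using G by (auto simp: simple_graph_def complement_graph_def)
  then obtain X where X: "X \<in> theta_feasible (complement_graph E)"
    and theta: "trace (all_ones ** X) = lovasz_theta (complement_graph E)"
    by (rule lovasz_theta_attained)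
  have psd: "pos_semidef X" and tr: "(\<Sum>i\<in>UNIV. X $ i $ i) = 1"
    using X by (auto simp: theta_feasible_def trace_def)
  have X0: "X $ i $ j = 0" if "i \<noteq> j" "\<not> E i j" for i j
    using X that by (auto simp: theta_feasible_def complement_graph_def)
  have sym: "X $ i $ j = X $ j $ i" for i j
    using psd by (auto simp: pos_semidef_def sym_matrix_def vec_eq_iff transpose_def)
  have diag: "0 \<le> X $ i $ i" for i
  proof -
    have "0 \<le> axis i 1 \<bullet> (X *v axis i 1)" using psd by (simp add: pos_semidef_def)
    then show ?thesis by (simp add: inner_axis' matrix_vector_mul_component inner_axis)
  qed
  define d :: "real^'v" where "d = (\<chi> i. sqrt (X $ i $ i))"
  (* Where d vanishes, x / 0 = 0 gives Z a zero row and column. *)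
  define Z :: "real^'v^'v" where "Z = (\<chi> i j. if i = j then 0 else X $ i $ j / (d $ i * d $ j))"
  have dd: "d $ i * d $ i = X $ i $ i" for i using diag by (simp add: d_def)
  have d1: "d \<bullet> d = 1" using tr dd by (simp add: inner_vec_def)
  have Z: "supported_on E Z"
    using X0 sym by (auto simp: supported_on_def sym_matrix_def Z_def vec_eq_iff transpose_def mult.commute)
  have lower: "- (y \<bullet> y) \<le> y \<bullet> (Z *v y)" for y
  proof -
    \<comment> \<open>Entrywise division by \<open>d\<close> undoes the scaling of \<open>X\<close>.
      Coordinates with \<open>d $ i = 0\<close> become 0, so there \<open>y $ i * y $ i\<close>
      appears only on the right; hence an inequality below, not an equation.\<close>
    define z where "z = (\<chi> i. y $ i / d $ i)"
    have "0 \<le> z \<bullet> (X *v z)" using psd by (simp add: pos_semidef_def)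
    also have "\<dots> \<le> (\<Sum>i\<in>UNIV. \<Sum>j\<in>UNIV. y $ i * (Z $ i $ j * y $ j) + (if j = i then y $ i * y $ i else 0))"
      unfolding quad_form
    proof (intro sum_mono)
      fix i j
      show "z $ i * (X $ i $ j * z $ j) \<le> y $ i * (Z $ i $ j * y $ j) + (if j = i then y $ i * y $ i else 0)"
      proof (cases "i = j")
        case True
        then show ?thesis unfolding z_def Z_def by (cases "d $ i = 0") (simp_all flip: dd)
      qed (simp add: z_def Z_def)
    qed
    also have "\<dots> = y \<bullet> (Z *v y) + y \<bullet> y"
      unfolding quad_form by (simp add: sum.distrib inner_vec_def)
    finally show ?thesis by simp
  qed
  \<comment> \<open>Where \<open>d\<close> vanishes, the row and column of \<open>Z\<close> are zero
    by definition; those of \<open>X\<close> are zero as well, by positive semidefiniteness.\<close>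
  have entry: "X $ i $ j = d $ i * (Z $ i $ j * d $ j) + (if j = i then X $ i $ i else 0)" for i j
  proof (cases "i \<noteq> j \<and> (d $ i = 0 \<or> d $ j = 0)")
    case True
    then have "X $ i $ i = 0 \<or> X $ j $ j = 0" using dd[of i] dd[of j] by auto
    then have "X $ i $ j = 0" using pos_semidef_zero_diagonal[OF psd] sym by metis
    then show ?thesis using True by auto
  qed (auto simp: Z_def)
  have "(\<Sum>i\<in>UNIV. \<Sum>j\<in>UNIV. X $ i $ j)
      = (\<Sum>i\<in>UNIV. \<Sum>j\<in>UNIV. d $ i * (Z $ i $ j * d $ j) + (if j = i then X $ i $ i else 0))"
    by (intro sum.cong refl entry)
  also have "\<dots> = d \<bullet> (Z *v d) + 1"
    using tr by (simp add: sum.distrib quad_form)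
  finally have "(\<Sum>i\<in>UNIV. \<Sum>j\<in>UNIV. X $ i $ j) = d \<bullet> (Z *v d) + 1" .
  moreover have "trace (all_ones ** X) = (\<Sum>i\<in>UNIV. \<Sum>j\<in>UNIV. X $ i $ j)"
    by (simp add: trace_def all_ones_def matrix_matrix_mult_def) (rule sum.swap)
  ultimately have val: "lovasz_theta (complement_graph E) = d \<bullet> (Z *v d) + 1"
    using theta by simp
  have "sym_matrix Z" using Z by (simp add: supported_on_def)
  then obtain e where on: "\<And>i. i \<in> {1..n} \<Longrightarrow> e i \<bullet> e i = 1"
    and eig: "\<And>i. i \<in> {1..n} \<Longrightarrow> Z *v e i = eigval i Z *\<^sub>R e i"
    and mono: "\<And>i j. 1 \<le> i \<Longrightarrow> i \<le> j \<Longrightarrow> j \<le> n \<Longrightarrow> eigval j Z \<le> eigval i Z"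
    and qf: "\<And>x. x \<bullet> x = (\<Sum>i=1..n. (x \<bullet> e i)\<^sup>2)"
      "\<And>x. x \<bullet> (Z *v x) = (\<Sum>i=1..n. eigval i Z * (x \<bullet> e i)\<^sup>2)"
    using sym_matrix_eigval_basis[of Z, folded n_def] by blast
  have "d \<bullet> (Z *v d) \<le> (\<Sum>i=1..n. eigval 1 Z * (d \<bullet> e i)\<^sup>2)"
    unfolding qf(2) using mono by (intro sum_mono mult_right_mono) auto
  also have "\<dots> = eigval 1 Z"
    using d1 by (simp add: qf(1) flip: sum_distrib_left)
  finally have "d \<bullet> (Z *v d) \<le> eigval 1 Z" .
  moreover have "eigval 1 Z + (\<Sum>i = 1..m - 1. eigval (n + 1 - i) Z) \<le> 0"
    using m(1) Z by (simp add: h_admissible_def n_def)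
  moreover have "(\<Sum>i = 1..m - 1. - 1) \<le> (\<Sum>i = 1..m - 1. eigval (n + 1 - i) Z)"
  proof (rule sum_mono)
    fix i assume "i \<in> {1..m - 1}"
    \<comment> \<open>The bound \<open>m \<le> CARD('v)\<close> keeps these indices at least 1, so
      each \<open>eigval\<close> here is a genuine eigenvalue with unit eigenvector.\<close>
    then have "n + 1 - i \<in> {1..n}" using m(2) by (auto simp: n_def)
    then show "- 1 \<le> eigval (n + 1 - i) Z"
      using lower[of "e (n + 1 - i)"] on[of "n + 1 - i"] eig[of "n + 1 - i"] by simp
  qed
  moreover have "1 \<le> m" using m(1) by (simp add: h_admissible_def)
  ultimately show ?thesis using val by (simp add: of_nat_diff)
qed

theorem theorem2:
  fixes E :: "'v::finite \<Rightarrow> 'v \<Rightarrow> bool"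
  assumes "simple_graph E"
  shows "\<lceil>lovasz_theta (complement_graph E)\<rceil> \<le> int (h_number E) \<and> h_number E \<le> chromatic_number E"
proof -
  have h: "h_number E = (LEAST m. h_admissible E m)"
    by (simp add: h_number_def h_admissible_def)
  have le: "h_number E \<le> chromatic_number E"
    unfolding h by (rule Least_le) (rule h_admissible_chromatic_number[OF assms])
  \<comment> \<open>Admissibility of the chromatic number also shows that the \<open>LEAST\<close>
    ranges over a nonempty set, so its value satisfies the condition.\<close>
  have "h_admissible E (h_number E)"
    unfolding h by (rule LeastI) (rule h_admissible_chromatic_number[OF assms])
  then have "lovasz_theta (complement_graph E) \<le> real (h_number E)"
    \<comment> \<open>The size bound required of \<open>m\<close> comes from the chain
      \<open>h_number E \<le> chromatic_number E \<le> CARD('v)\<close>, so the upper bound feeds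
      the lower one.\<close>
    using le colorable_chromatic_number(2)[OF assms] assms
    by (intro lovasz_theta_le_h_admissible) auto
  then show ?thesis using le by (simp add: ceiling_le_iff)
qed

end
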